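(* Let $D\subset\mathbb{R}^3$ be an open set and let $f:D\to\mathbb{R}$ and $g=(g_1,g_2):D\to\mathbb{R}^2$ be twice continuously differentiable. Let $x^*\in D$ be a critical point for the problem of minimizing $f(x)$ subject to $g(x)=0$, and let $\lambda^*=(\lambda_1^*,\lambda_2^* )\in\mathbb{R}^2$ be the vector of Lagrange multipliers, i.e. $\nabla f(x^* )+\lambda_1^*\nabla g_1(x^* )+\lambda_2^*\nabla g_2(x^* )=0$ and $g_1(x^* )=g_2(x^* )=0$. Define $H=\nabla^2 f(x^* )+\lambda_1^*\nabla^2 g_1(x^* )+\lambda_2^*\nabla^2 g_2(x^* )\in\mathbb{R}^{3\times 3}$. Suppose that $\nabla g_1(x^* )$ and $\nabla g_2(x^* )$ are linearly independent and take a nonzero vector $v\in\mathbb{R}^3$ such that $v\perp\nabla g_1(x^* )$ and $v\perp\nabla g_2(x^* )$. If $v^T H v>0$, then $x^*$ is a local minimizer for the problem.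
   Context: The problem is: minimize $f(x)$ subject to $g(x)=0$, with feasible set $\Omega=\{x\in D\mid g(x)=0\}$. A point $x^*\in\Omega$ is a local minimizer of the problem if there exists $\delta>0$ such that $f(x^* )\leq f(x)$ for all $x\in\Omega\cap B(x^*,\delta)$, where $B(x^*,\delta)$ is the Euclidean ball of center $x^*$ and radius $\delta$. Here $\nabla$ denotes the gradient (a column vector), $\nabla^2$ the Hessian matrix, and $\perp$ orthogonality with respect to the standard inner product. *)

theory Defs
  imports "HOL-Analysis.Analysis"
begin

definition gradient :: "('a::real_inner \<Rightarrow> real) \<Rightarrow> 'a \<Rightarrow> 'a" where
  "gradient f x = (THE d. GDERIV f x :> d)"

lemma gradient_works:
  fixes f :: "'a::euclidean_space \<Rightarrow> real"
  assumes "f differentiable (at x)"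
  shows "GDERIV f x :> gradient f x"
proof -
  obtain f' where f': "(f has_derivative f') (at x)" using assms unfolding differentiable_def by blast
  interpret bounded_linear f' using f' by (rule has_derivative_bounded_linear)
  define d where "d = (\<Sum>b\<in>Basis. f' b *\<^sub>R b)"
  have "f' h = inner h d" for h
  proof -
    have "f' h = f' (\<Sum>b\<in>Basis. (h \<bullet> b) *\<^sub>R b)" by (simp add: euclidean_representation)
    also have "\<dots> = (\<Sum>b\<in>Basis. (h \<bullet> b) * f' b)" by (simp add: sum scaleR)
    finally show ?thesis by (simp add: d_def inner_sum_right mult.commute)
  qed
  then have "f' = (\<lambda>h. inner h d)" by auto
  with f' have d: "GDERIV f x :> d" by (simp add: gderiv_def)
  moreover have "e = d" if "GDERIV f x :> e" for e
  proof -
    have "(\<lambda>h. inner h e) = (\<lambda>h. inner h d)"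
      using that d unfolding gderiv_def by (rule has_derivative_unique)
    then have "inner (e-d) e = inner (e-d) d" by meson
    then have "inner (e - d) (e - d) = 0" by (simp only: inner_diff_right diff_self)
    then show ?thesis by simp
  qed
  ultimately show ?thesis unfolding gradient_def by (rule theI)
qed

text \<open>The entry in row \<open>i\<close>, column \<open>j\<close> is the \<open>j\<close>-th partial derivative of the
  \<open>i\<close>-th component of the gradient.\<close>

definition hessian :: "(real ^ 'n \<Rightarrow> real) \<Rightarrow> real ^ 'n \<Rightarrow> real ^ 'n ^ 'n" where
  "hessian f x = jacobian (gradient f) (at x)"

text \<open>Meant for open \<open>D\<close>: only the values of \<open>f\<close> on \<open>D\<close> then matter. Continuity of \<open>f\<close> and
  of its gradient follows from differentiability.\<close>

definition twice_continuously_differentiable_on ::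
    "(real ^ 'n \<Rightarrow> real) \<Rightarrow> (real ^ 'n) set \<Rightarrow> bool" where
  "twice_continuously_differentiable_on f D \<longleftrightarrow>
     (\<forall>x\<in>D. f differentiable (at x)) \<and>
     (\<forall>x\<in>D. gradient f differentiable (at x)) \<and>
     continuous_on D (hessian f)"

definition feasible_set :: "'a set \<Rightarrow> ('a \<Rightarrow> 'b::zero) \<Rightarrow> 'a set" where
  "feasible_set D g = {x \<in> D. g x = 0}"

definition local_minimizer ::
    "('a::metric_space) set \<Rightarrow> ('a \<Rightarrow> real) \<Rightarrow> ('a \<Rightarrow> 'b::zero) \<Rightarrow> 'a \<Rightarrow> bool" where
  "local_minimizer D f g x \<longleftrightarrow>
     x \<in> feasible_set D g \<and>
     (\<exists>\<delta>>0. \<forall>y \<in> feasible_set D g \<inter> ball x \<delta>. f x \<le> f y)"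

end

theory Submission
  imports Defs
begin

text \<open>
  If \<open>x\<close> were not a local minimizer, some feasible sequence \<open>y\<^sub>n \<rightarrow> x\<close> would satisfy
  \<open>f y\<^sub>n < f x\<close>, and after passing to a subsequence the directions of \<open>y\<^sub>n - x\<close> would converge to a
  unit vector \<open>u\<close>. Differentiating the constraints along the sequence shows that \<open>u\<close> is orthogonal to
  both constraint gradients, so in dimension three \<open>u\<close> is a multiple of \<open>v\<close> and \<open>u\<^sup>T H u > 0\<close>.
  The Lagrangian \<open>L\<close> agrees with \<open>f\<close> on the feasible set. By the mean value theorem its gradient has a
  negative component along \<open>y\<^sub>n - x\<close> at some point of the segment from \<open>x\<close> to \<open>y\<^sub>n\<close>; since that
  gradient vanishes at \<open>x\<close> and has derivative \<open>H\<close> there, the limit gives \<open>u\<^sup>T H u \<le> 0\<close>.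
\<close>

text \<open>Dividing the first-order expansion at \<open>y n\<close> by
  \<open>norm (y n - x)\<close> sends the remainder to 0 and turns the linear term into
  \<open>A (sgn (y n - x))\<close>, which tends to \<open>A u\<close> by continuity of
  \<open>A\<close>.\<close>

lemma has_derivative_along_sequence:
  fixes F :: "'a::real_normed_vector \<Rightarrow> 'b::real_normed_vector"
  assumes F: "(F has_derivative A) (at x)"
    and y: "y \<longlonglongrightarrow> x" "\<And>n. y n \<noteq> x"
    and u: "(\<lambda>n. sgn (y n - x)) \<longlonglongrightarrow> u"
  shows "(\<lambda>n. (F (y n) - F x) /\<^sub>R norm (y n - x)) \<longlonglongrightarrow> A u"
proof -
  interpret bounded_linear A using F by (rule has_derivative_bounded_linear)
  have "((\<lambda>z. (F z - F x - A (z - x)) /\<^sub>R norm (z - x)) \<longlongrightarrow> 0) (at x)"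
    using F by (simp add: has_derivative_at_within)
  moreover have "filterlim y (at x) sequentially"
    using y by (simp add: filterlim_at)
  ultimately have "(\<lambda>n. (F (y n) - F x - A (y n - x)) /\<^sub>R norm (y n - x)) \<longlonglongrightarrow> 0"
    by (rule filterlim_compose)
  moreover have "(\<lambda>n. A (sgn (y n - x))) \<longlonglongrightarrow> A u"
    using u by (rule tendsto)
  ultimately have "(\<lambda>n. (F (y n) - F x - A (y n - x)) /\<^sub>R norm (y n - x) + A (sgn (y n - x)))
      \<longlonglongrightarrow> 0 + A u"
    by (rule tendsto_add)
  then show ?thesis
    by (simp add: sgn_div_norm scaleR flip: scaleR_add_right)
qed

text \<open>The difference quotients along \<open>y\<close> vanish identically, so their limit does.
  Applied to a constraint function, this makes \<open>u\<close> a tangent direction.\<close>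

lemma derivative_limit_direction_eq_0:
  fixes F :: "'a::real_normed_vector \<Rightarrow> 'b::real_normed_vector"
  assumes "(F has_derivative A) (at x)" "y \<longlonglongrightarrow> x" "\<And>n. y n \<noteq> x"
    and "(\<lambda>n. sgn (y n - x)) \<longlonglongrightarrow> u" "\<And>n. F (y n) = F x"
  shows "A u = 0"
  using has_derivative_along_sequence[OF assms(1-4)] assms(5) by (simp add: LIMSEQ_const_iff)

lemma GDERIV_mvt_segment:
  fixes L :: "'a::real_inner \<Rightarrow> real"
  assumes "convex S" "x \<in> S" "y \<in> S" and L: "\<And>z. z \<in> S \<Longrightarrow> GDERIV L z :> G z"
  obtains t where "0 < t" "t < 1" "L y - L x = (y - x) \<bullet> G (x + t *\<^sub>R (y - x))"
proof -
  have "((\<lambda>t. L (x + t *\<^sub>R (y - x))) has_derivative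
      (\<lambda>s. (s *\<^sub>R (y - x)) \<bullet> G (x + t *\<^sub>R (y - x)))) (at t within {0..1})"
    if "t \<in> {0..1}" for t
  proof -
    have "(1 - t) *\<^sub>R x + t *\<^sub>R y \<in> S"
      using assms(1-3) that by (intro convexD) auto
    then have "x + t *\<^sub>R (y - x) \<in> S"
      by (simp add: algebra_simps)
    then have "(L has_derivative (\<lambda>h. h \<bullet> G (x + t *\<^sub>R (y - x)))) (at (x + t *\<^sub>R (y - x)))"
      using L by (simp add: gderiv_def)
    then show ?thesis
      by (rule has_derivative_compose[rotated]) (auto intro!: derivative_eq_intros)
  qed
  \<comment> \<open>The factors 1, 0 and \<open>1 - 0\<close> are left unsimplified so that the
    statement matches \<open>mvt_simple\<close> on the unit interval.\<close>
  then have "\<exists>t\<in>{0<..<1}. L (x + 1 *\<^sub>R (y - x)) - L (x + 0 *\<^sub>R (y - x)) =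
      ((1 - 0) *\<^sub>R (y - x)) \<bullet> G (x + t *\<^sub>R (y - x))"
    by (intro mvt_simple) auto
  then show ?thesis
    using that by auto
qed

text \<open>Instead of a second-order Taylor expansion, the mean value theorem gives intermediate
  points at which \<open>G\<close> is then expanded to first order around \<open>x\<close>.\<close>

lemma second_derivative_limit_direction_nonpos:
  fixes L :: "'a::real_inner \<Rightarrow> real"
  assumes "open S" "x \<in> S" and L: "\<And>z. z \<in> S \<Longrightarrow> GDERIV L z :> G z"
    and G: "G x = 0" "(G has_derivative A) (at x)"
    and y: "y \<longlonglongrightarrow> x" "\<And>n. y n \<noteq> x"
    and u: "(\<lambda>n. sgn (y n - x)) \<longlonglongrightarrow> u"
    and le: "\<And>n. L (y n) \<le> L x"
  shows "u \<bullet> A u \<le> 0"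
proof -
  obtain r where r: "r > 0" "ball x r \<subseteq> S"
    using assms(1,2) by (auto simp: open_contains_ball)
  have "\<exists>t. 0 < t \<and> t < 1 \<and> (y n \<in> ball x r \<longrightarrow> (y n - x) \<bullet> G (x + t *\<^sub>R (y n - x)) \<le> 0)" for n
  proof (cases "y n \<in> ball x r")
    case True
    obtain t where "0 < t" "t < 1" "L (y n) - L x = (y n - x) \<bullet> G (x + t *\<^sub>R (y n - x))"
      using L r True by (rule_tac GDERIV_mvt_segment[of "ball x r" x "y n" L G]) auto
    then show ?thesis
      using le[of n] by auto
  next
    \<comment> \<open>Outside the ball any value in the open unit interval serves; it only makes
      \<open>t n\<close> available for every \<open>n\<close>.\<close>
    case False
    then show ?thesis
      by (intro exI[of _ "1/2"]) auto
  qed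
  then obtain t where t: "\<And>n. 0 < t n" "\<And>n. t n < 1"
    and nonpos: "\<And>n. y n \<in> ball x r \<Longrightarrow> (y n - x) \<bullet> G (x + t n *\<^sub>R (y n - x)) \<le> 0"
    by metis
  define z where "z n = x + t n *\<^sub>R (y n - x)" for n
  \<comment> \<open>Scaling by \<open>t n > 0\<close> preserves directions, so the intermediate
    points approach \<open>x\<close> with the same limit direction \<open>u\<close>.\<close>
  have sgn_z: "sgn (z n - x) = sgn (y n - x)" for n
    using t[of n] by (simp add: z_def sgn_scaleR)
  have "(\<lambda>n. z n - x) \<longlonglongrightarrow> 0"
  proof (rule Lim_null_comparison)
    show "\<forall>\<^sub>F n in sequentially. norm (z n - x) \<le> norm (y n - x)"
      using t by (intro always_eventually allI) (simp add: z_def mult_left_le_one_le less_imp_le)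
    show "(\<lambda>n. norm (y n - x)) \<longlonglongrightarrow> 0"
      using y(1) by (simp add: LIM_zero_iff tendsto_norm_zero)
  qed
  then have "z \<longlonglongrightarrow> x"
    by (simp add: LIM_zero_iff)
  moreover have "z n \<noteq> x" for n
    using t(1)[of n] y(2)[of n] by (simp add: z_def)
  ultimately have "(\<lambda>n. (G (z n) - G x) /\<^sub>R norm (z n - x)) \<longlonglongrightarrow> A u"
    using G(2) u by (intro has_derivative_along_sequence) (simp_all add: sgn_z)
  with u have lim: "(\<lambda>n. sgn (y n - x) \<bullet> (G (z n) /\<^sub>R norm (z n - x))) \<longlonglongrightarrow> u \<bullet> A u"
    unfolding G(1) diff_zero by (rule tendsto_inner)
  have "\<forall>\<^sub>F n in sequentially. y n \<in> ball x r"
    using y(1) r(1) by (intro topological_tendstoD) auto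
  then have "\<forall>\<^sub>F n in sequentially. sgn (y n - x) \<bullet> (G (z n) /\<^sub>R norm (z n - x)) \<le> 0"
  proof eventually_elim
    case (elim n)
    then show ?case
      using nonpos[of n] by (simp add: z_def sgn_div_norm mult_nonneg_nonpos)
  qed
  with lim show ?thesis
    by (intro tendsto_upperbound) auto
qed

lemma sgn_convergent_subsequence:
  fixes y :: "nat \<Rightarrow> 'a::euclidean_space"
  assumes "\<And>n. y n \<noteq> x"
  obtains u k where "norm u = 1" "strict_mono k" "(\<lambda>n. sgn (y (k n) - x)) \<longlonglongrightarrow> u"
proof -
  have "\<forall>n. sgn (y n - x) \<in> sphere 0 1"
    using assms by (simp add: norm_sgn)
  then obtain u k where "u \<in> sphere 0 1" "strict_mono k" "((\<lambda>n. sgn (y n - x)) \<circ> k) \<longlonglongrightarrow> u"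
    using compact_sphere[of "0::'a" 1] unfolding compact_def by metis
  with that show ?thesis
    by (simp add: comp_def)
qed

text \<open>The orthogonal complement of \<open>span B\<close> is a line, and the nonzero vector
  \<open>v\<close> spans it.\<close>

lemma orthogonal_to_hyperplane_collinear:
  fixes B :: "'a::euclidean_space set"
  assumes "independent B" "Suc (card B) = DIM('a)"
    and v: "v \<noteq> 0" "\<And>b. b \<in> B \<Longrightarrow> orthogonal v b"
    and u: "\<And>b. b \<in> B \<Longrightarrow> orthogonal u b"
  obtains c where "u = c *\<^sub>R v"
proof -
  define W where "W = {w. \<forall>b\<in>span B. orthogonal b w}"
  have "dim W + dim (span B) = DIM('a)"
    using dim_subspace_orthogonal_to_vectors[of "span B" UNIV] by (simp add: W_def)
  then have "dim W = 1"
    using assms(1,2) by (simp add: dim_eq_card_independent)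
  moreover have "subspace W"
    unfolding W_def by (rule subspace_orthogonal_to_vectors)
  moreover have "v \<in> W" "u \<in> W"
    using v(2) u by (simp_all add: W_def) (metis orthogonal_commute orthogonal_to_span)+
  ultimately have "span {v} = W"
    using v(1) by (intro subspace_dim_equal) (auto simp: span_minimal subspace_span)
  with \<open>u \<in> W\<close> that show ?thesis
    by (auto simp: span_singleton)
qed

theorem theorem4p7:
  fixes D :: "(real ^ 3) set"
    and f :: "real ^ 3 \<Rightarrow> real"
    and g :: "real ^ 3 \<Rightarrow> real ^ 2"
    and g1 g2 :: "real ^ 3 \<Rightarrow> real"
    and x v :: "real ^ 3"
    and lam :: "real ^ 2"
    and H :: "real ^ 3 ^ 3"
  assumes "open D"
    and g1: "g1 = (\<lambda>y. g y $ 1)"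
    and g2: "g2 = (\<lambda>y. g y $ 2)"
    and "twice_continuously_differentiable_on f D"
    and "twice_continuously_differentiable_on g1 D"
    and "twice_continuously_differentiable_on g2 D"
    and "x \<in> D"
    and "gradient f x + lam $ 1 *\<^sub>R gradient g1 x + lam $ 2 *\<^sub>R gradient g2 x = 0"
    and "g x = 0"
    and H: "H = hessian f x + lam $ 1 *\<^sub>R hessian g1 x + lam $ 2 *\<^sub>R hessian g2 x"
    and "gradient g1 x \<noteq> gradient g2 x"
    and "independent {gradient g1 x, gradient g2 x}"
    and "v \<noteq> 0"
    and "orthogonal v (gradient g1 x)"
    and "orthogonal v (gradient g2 x)"
    and "v \<bullet> (H *v v) > 0"
  shows "local_minimizer D f g x"
proof -
  have H_has_derivative: "(gradient h has_derivative (*v) (hessian h x)) (at x)"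
    if "twice_continuously_differentiable_on h D" for h :: "real ^ 3 \<Rightarrow> real"
    using that \<open>x \<in> D\<close> jacobian_works[of "gradient h" "at x"]
    by (simp add: twice_continuously_differentiable_on_def hessian_def)
  have gderiv: "GDERIV h z :> gradient h z"
    if "twice_continuously_differentiable_on h D" "z \<in> D" for h :: "real ^ 3 \<Rightarrow> real" and z
    using that by (simp add: twice_continuously_differentiable_on_def gradient_works)
  define L where "L z = f z + lam $ 1 * g1 z + lam $ 2 * g2 z" for z
  define G where "G z = gradient f z + lam $ 1 *\<^sub>R gradient g1 z + lam $ 2 *\<^sub>R gradient g2 z" for z
  have L: "GDERIV L z :> G z" if "z \<in> D" for z
    unfolding L_def G_def gderiv_def inner_add_right inner_scaleR_right
    using assms(4-6) that
    by (intro has_derivative_add has_derivative_mult_right gderiv[unfolded gderiv_def])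
  have G: "G x = 0" "(G has_derivative (*v) H) (at x)"
  proof -
    show "G x = 0"
      using assms(8) by (simp add: G_def)
    show "(G has_derivative (*v) H) (at x)"
      unfolding G_def H matrix_vector_mult_add_rdistrib scaleR_matrix_vector_assoc[symmetric]
      using assms(4-6)
      by (intro has_derivative_add has_derivative_scaleR_right H_has_derivative)
  qed
  \<comment> \<open>The multiplier terms vanish on the feasible set, so a decrease of
    \<open>f\<close> there is a decrease of \<open>L\<close>.\<close>
  have L_feasible: "L z = f z" "g1 z = g1 x" "g2 z = g2 x" if "z \<in> feasible_set D g" for z
    using that \<open>g x = 0\<close> by (simp_all add: L_def g1 g2 feasible_set_def)
  have x: "x \<in> feasible_set D g"
    using \<open>x \<in> D\<close> \<open>g x = 0\<close> by (simp add: feasible_set_def)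
  show ?thesis
  proof (rule ccontr)
    assume "\<not> ?thesis"
    with x have "\<exists>y\<in>feasible_set D g \<inter> ball x (inverse (Suc n)). f y < f x" for n
      by (auto simp: local_minimizer_def not_le dest!: spec[of _ "inverse (Suc n)"])
    then obtain y where y: "\<And>n. y n \<in> feasible_set D g" "\<And>n. f (y n) < f x"
      and dist_y: "\<And>n. dist x (y n) < inverse (Suc n)"
      by (metis IntE mem_ball)
    have "(\<lambda>n. dist (y n) x) \<longlonglongrightarrow> 0"
      using dist_y by (intro tendsto_sandwich[OF _ _ tendsto_const LIMSEQ_inverse_real_of_nat])
        (auto simp: dist_commute intro!: always_eventually less_imp_le)
    then have "y \<longlonglongrightarrow> x"
      by (rule iffD2[OF tendsto_dist_iff])
    \<comment> \<open>The strict decrease of \<open>f\<close> excludes \<open>x\<close> itself, so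
      the directions are unit vectors.\<close>
    have "y n \<noteq> x" for n
      using y(2)[of n] by auto
    then obtain u k where u: "norm u = 1" and k: "strict_mono k"
      and lim: "(\<lambda>n. sgn (y (k n) - x)) \<longlonglongrightarrow> u"
      by (rule sgn_convergent_subsequence)
    have yk: "(\<lambda>n. y (k n)) \<longlonglongrightarrow> x"
      using LIMSEQ_subseq_LIMSEQ[OF \<open>y \<longlonglongrightarrow> x\<close> k] by (simp add: comp_def)
    have "u \<bullet> (H *v u) \<le> 0"
      using y x \<open>\<And>n. y n \<noteq> x\<close>
      by (intro second_derivative_limit_direction_nonpos[OF \<open>open D\<close> \<open>x \<in> D\<close> L G yk _ lim])
        (auto simp: L_feasible less_imp_le)
    moreover have "orthogonal u (gradient h x)"
      if "twice_continuously_differentiable_on h D" "\<And>n. h (y n) = h x" for h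
      using derivative_limit_direction_eq_0[OF gderiv[OF that(1) \<open>x \<in> D\<close>, unfolded gderiv_def] yk _ lim]
        \<open>\<And>n. y n \<noteq> x\<close> that(2) by (simp add: orthogonal_def)
    then have "orthogonal u (gradient g1 x)" "orthogonal u (gradient g2 x)"
      using assms(5,6) L_feasible(2,3) y(1) by blast+
    \<comment> \<open>Since the two gradients are distinct, the set they form has cardinality 2, one
      less than the dimension of the space.\<close>
    then obtain c where c: "u = c *\<^sub>R v"
      using assms(11-15) by (rule_tac orthogonal_to_hyperplane_collinear
          [of "{gradient g1 x, gradient g2 x}" v u]) auto
    then have "u \<bullet> (H *v u) = c\<^sup>2 * (v \<bullet> (H *v v))"
      by (simp add: matrix_vector_mult_scaleR power2_eq_square)
    \<comment> \<open>Otherwise \<open>u\<close> would be 0, against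
      \<open>norm u = 1\<close>.\<close>
    moreover have "c \<noteq> 0"
      using u c by auto
    ultimately show False
      using \<open>v \<bullet> (H *v v) > 0\<close> by (simp add: mult_le_0_iff)
  qed
qed

end
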